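(* Let $R$ be a commutative ring with identity which is a Prüfer ring, let $Z(R)$ be the set of zero-divisors of $R$, and let $S$ be a multiplicative subset of $R$ which is contained in $R\setminus Z(R)$. Then the localization $S^{-1}R$ is a Prüfer ring.
   Context: All rings are commutative with identity. For a ring $R$, $Z(R)$ denotes the set of zero-divisors of $R$ (including $0$), and $\mathrm{Tot}(R)=(R\setminus Z(R))^{-1}R$ is its total ring of quotients. An element of $R$ is regular if it is not in $Z(R)$; an ideal of $R$ is regular if it contains a regular element. A regular ideal $I$ is invertible if $I\,I^{-1}=R$, where $I^{-1}=\{x\in \mathrm{Tot}(R) : xI\subseteq R\}$. $R$ is a Prüfer ring if every finitely generated regular ideal of $R$ is invertible. *)

theory Defs
  imports "HOL-Algebra.Ideal_Product"
begin

text \<open>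
  Localization \<open>S\<^sup>-\<^sup>1R\<close>: its elements are the classes \<open>a/s\<close> of pairs \<open>(a, s)\<close> with \<open>s \<in> S\<close>,
  where \<open>a/s = b/t\<close> iff \<open>u (t a) = u (s b)\<close> for some \<open>u \<in> S\<close>.
  It is meant for \<open>S\<close> a multiplicative subset of \<open>R\<close>, i.e. \<open>submonoid S R\<close>.
\<close>

definition frac_rel :: "('a, 'm) ring_scheme \<Rightarrow> 'a set \<Rightarrow> (('a \<times> 'a) \<times> ('a \<times> 'a)) set" where
  "frac_rel R S = {((a, s), (b, t)). a \<in> carrier R \<and> s \<in> S \<and> b \<in> carrier R \<and> t \<in> S \<and>
     (\<exists>u\<in>S. u \<otimes>\<^bsub>R\<^esub> (t \<otimes>\<^bsub>R\<^esub> a) = u \<otimes>\<^bsub>R\<^esub> (s \<otimes>\<^bsub>R\<^esub> b))}"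

definition frac :: "('a, 'm) ring_scheme \<Rightarrow> 'a set \<Rightarrow> 'a \<Rightarrow> 'a \<Rightarrow> ('a \<times> 'a) set" where
  "frac R S a s = frac_rel R S `` {(a, s)}"

text \<open>The unions below range over all representatives and collapse to a single class
  (see \<open>localization_mult\<close> and \<open>localization_add\<close>).\<close>

definition localization :: "('a, 'm) ring_scheme \<Rightarrow> 'a set \<Rightarrow> ('a \<times> 'a) set ring" where
  "localization R S = \<lparr>
     carrier = (carrier R \<times> S) // frac_rel R S,
     mult = (\<lambda>P Q. \<Union>(a, s)\<in>P. \<Union>(b, t)\<in>Q. frac R S (a \<otimes>\<^bsub>R\<^esub> b) (s \<otimes>\<^bsub>R\<^esub> t)),
     one = frac R S \<one>\<^bsub>R\<^esub> \<one>\<^bsub>R\<^esub>,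
     zero = frac R S \<zero>\<^bsub>R\<^esub> \<one>\<^bsub>R\<^esub>,
     add = (\<lambda>P Q. \<Union>(a, s)\<in>P. \<Union>(b, t)\<in>Q.
              frac R S (t \<otimes>\<^bsub>R\<^esub> a \<oplus>\<^bsub>R\<^esub> s \<otimes>\<^bsub>R\<^esub> b) (s \<otimes>\<^bsub>R\<^esub> t)) \<rparr>"

definition zero_divisors :: "('a, 'm) ring_scheme \<Rightarrow> 'a set" where
  "zero_divisors R = {x \<in> carrier R. x = \<zero>\<^bsub>R\<^esub> \<or>
     (\<exists>y\<in>carrier R. y \<noteq> \<zero>\<^bsub>R\<^esub> \<and> x \<otimes>\<^bsub>R\<^esub> y = \<zero>\<^bsub>R\<^esub>)}"

definition regular_elements :: "('a, 'm) ring_scheme \<Rightarrow> 'a set" where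
  "regular_elements R = carrier R - zero_divisors R"

definition Tot :: "('a, 'm) ring_scheme \<Rightarrow> ('a \<times> 'a) set ring" where
  "Tot R = localization R (regular_elements R)"

text \<open>The canonical map \<open>a \<mapsto> a/1\<close>, by which \<open>R\<close> is regarded as a subring of \<open>Tot R\<close>.\<close>

definition to_Tot :: "('a, 'm) ring_scheme \<Rightarrow> 'a \<Rightarrow> ('a \<times> 'a) set" where
  "to_Tot R a = frac R (regular_elements R) a \<one>\<^bsub>R\<^esub>"

definition regular_ideal :: "'a set \<Rightarrow> ('a, 'm) ring_scheme \<Rightarrow> bool" where
  "regular_ideal I R \<longleftrightarrow> ideal I R \<and> (\<exists>x\<in>I. x \<in> regular_elements R)"

definition finitely_generated_ideal :: "'a set \<Rightarrow> ('a, 'm) ring_scheme \<Rightarrow> bool" where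
  "finitely_generated_ideal I R \<longleftrightarrow> (\<exists>A\<subseteq>carrier R. finite A \<and> I = Idl\<^bsub>R\<^esub> A)"

definition ideal_inverse :: "('a, 'm) ring_scheme \<Rightarrow> 'a set \<Rightarrow> ('a \<times> 'a) set set" where
  "ideal_inverse R I = {x \<in> carrier (Tot R).
     \<forall>a\<in>I. x \<otimes>\<^bsub>Tot R\<^esub> to_Tot R a \<in> to_Tot R ` carrier R}"

text \<open>\<open>I I\<^sup>-\<^sup>1 = R\<close> is an equation between subsets of \<open>Tot R\<close>.  The library's \<open>ideal_prod\<close> consists
  of the finite sums of products of elements of its two arguments, which need not be ideals.\<close>

definition invertible_ideal :: "'a set \<Rightarrow> ('a, 'm) ring_scheme \<Rightarrow> bool" where
  "invertible_ideal I R \<longleftrightarrow> regular_ideal I R \<and>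
     ideal_prod (Tot R) (to_Tot R ` I) (ideal_inverse R I) = to_Tot R ` carrier R"

locale pruefer_ring = cring +
  assumes fin_gen_regular_invertible:
    "\<lbrakk> finitely_generated_ideal I R; regular_ideal I R \<rbrakk> \<Longrightarrow> invertible_ideal I R"


lemma submonoid_regular_elements:
  assumes "cring R" "\<one>\<^bsub>R\<^esub> \<noteq> \<zero>\<^bsub>R\<^esub>"
  shows "submonoid (regular_elements R) R"
proof -
  interpret cring R by fact
  show ?thesis
  proof
    show "regular_elements R \<subseteq> carrier R" by (auto simp: regular_elements_def)
    show "\<one>\<^bsub>R\<^esub> \<in> regular_elements R"
      using assms(2) by (auto simp: regular_elements_def zero_divisors_def)
    fix x y assume "x \<in> regular_elements R" "y \<in> regular_elements R"
    then show "x \<otimes>\<^bsub>R\<^esub> y \<in> regular_elements R"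
      unfolding regular_elements_def zero_divisors_def
      by (auto simp: m_assoc)
  qed
qed

context
  fixes R (structure) and S
  assumes R: "cring R" and S: "submonoid S R"
begin

interpretation cring R by (rule R)
interpretation submonoid S R by (rule S)

lemma submonoid_carrier: "s \<in> S \<Longrightarrow> s \<in> carrier R"
  using subset by auto

lemma equiv_frac_rel: "equiv (carrier R \<times> S) (frac_rel R S)"
proof (rule equivI)
  show "frac_rel R S \<subseteq> (carrier R \<times> S) \<times> (carrier R \<times> S)" by (auto simp: frac_rel_def)
  show "refl_on (carrier R \<times> S) (frac_rel R S)"
    by (auto simp: refl_on_def frac_rel_def)
  show "sym (frac_rel R S)" by (auto simp: sym_def frac_rel_def intro: sym)
  show "trans (frac_rel R S)"
  proof (rule transI)
    fix x y z assume "(x, y) \<in> frac_rel R S" "(y, z) \<in> frac_rel R S"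
    then obtain a s b t c r u v where x: "x = (a, s)" "y = (b, t)" "z = (c, r)"
      and c: "a \<in> carrier R" "b \<in> carrier R" "c \<in> carrier R"
      and S: "s \<in> S" "t \<in> S" "r \<in> S" "u \<in> S" "v \<in> S"
      and 1: "u \<otimes> (t \<otimes> a) = u \<otimes> (s \<otimes> b)" and 2: "v \<otimes> (r \<otimes> b) = v \<otimes> (t \<otimes> c)"
      by (auto simp: frac_rel_def)
    have S': "s \<in> carrier R" "t \<in> carrier R" "r \<in> carrier R" "u \<in> carrier R" "v \<in> carrier R"
      using S submonoid_carrier by auto
    have "(u \<otimes> v \<otimes> t) \<otimes> (r \<otimes> a) = v \<otimes> r \<otimes> (u \<otimes> (t \<otimes> a))" using c S' by (simp add: m_ac)
    also have "\<dots> = u \<otimes> s \<otimes> (v \<otimes> (r \<otimes> b))" unfolding 1 using c S' by (simp add: m_ac)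
    also have "\<dots> = (u \<otimes> v \<otimes> t) \<otimes> (s \<otimes> c)" unfolding 2 using c S' by (simp add: m_ac)
    finally show "(x, z) \<in> frac_rel R S"
      using c S by (auto simp: frac_rel_def x intro!: bexI[of _ "u \<otimes> v \<otimes> t"])
  qed
qed

lemma frac_eq_iff:
  assumes "a \<in> carrier R" "s \<in> S" "b \<in> carrier R" "t \<in> S"
  shows "frac R S a s = frac R S b t \<longleftrightarrow> (\<exists>u\<in>S. u \<otimes> (t \<otimes> a) = u \<otimes> (s \<otimes> b))"
  using eq_equiv_class_iff[OF equiv_frac_rel, of "(a, s)" "(b, t)"] assms
  by (auto simp: frac_def frac_rel_def)

lemma frac_closed: "a \<in> carrier R \<Longrightarrow> s \<in> S \<Longrightarrow> frac R S a s \<in> carrier (localization R S)"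
  by (auto simp: localization_def frac_def intro!: quotientI)

lemma localization_cases:
  assumes "x \<in> carrier (localization R S)"
  obtains a s where "a \<in> carrier R" "s \<in> S" "x = frac R S a s"
  using assms by (auto simp: localization_def frac_def elim!: quotientE)

lemma frac_congI:
  "\<lbrakk> a \<in> carrier R; s \<in> S; b \<in> carrier R; t \<in> S; u \<in> S; u \<otimes> (t \<otimes> a) = u \<otimes> (s \<otimes> b) \<rbrakk>
     \<Longrightarrow> frac R S a s = frac R S b t"
  by (auto simp: frac_eq_iff)

lemma localization_mult:
  assumes ab: "a \<in> carrier R" "s \<in> S" "b \<in> carrier R" "t \<in> S"
  shows "frac R S a s \<otimes>\<^bsub>localization R S\<^esub> frac R S b t = frac R S (a \<otimes> b) (s \<otimes> t)"
proof -
  have "congruent2 (frac_rel R S) (frac_rel R S)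
          (\<lambda>p q. case p of (a, s) \<Rightarrow> case q of (b, t) \<Rightarrow> frac R S (a \<otimes> b) (s \<otimes> t))"
  proof (rule congruent2_commuteI[OF equiv_frac_rel], goal_cases)
    case (1 y z)
    then show ?case by (auto simp: m_comm submonoid_carrier)
  next
    case (2 y z w)
    then obtain a s b t c r u where *: "y = (a, s)" "z = (b, t)" "w = (c, r)"
      and c: "a \<in> carrier R" "b \<in> carrier R" "c \<in> carrier R"
      and S: "s \<in> S" "t \<in> S" "r \<in> S" "u \<in> S"
      and e: "u \<otimes> (t \<otimes> a) = u \<otimes> (s \<otimes> b)"
      by (auto simp: frac_rel_def)
    have S': "s \<in> carrier R" "t \<in> carrier R" "r \<in> carrier R" "u \<in> carrier R"
      using S submonoid_carrier by auto
    have "u \<otimes> ((r \<otimes> t) \<otimes> (c \<otimes> a)) = r \<otimes> c \<otimes> (u \<otimes> (t \<otimes> a))" using c S' by (simp add: m_ac)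
    also have "\<dots> = u \<otimes> ((r \<otimes> s) \<otimes> (c \<otimes> b))" unfolding e using c S' by (simp add: m_ac)
    finally have "frac R S (c \<otimes> a) (r \<otimes> s) = frac R S (c \<otimes> b) (r \<otimes> t)"
      using c S by (intro frac_congI[of _ _ _ _ u]) auto
    then show ?case by (simp add: *)
  qed
  from UN_equiv_class2[OF equiv_frac_rel equiv_frac_rel this, of "(a, s)" "(b, t)"] ab
  show ?thesis by (simp add: localization_def frac_def case_prod_unfold)
qed

lemma localization_add:
  assumes ab: "a \<in> carrier R" "s \<in> S" "b \<in> carrier R" "t \<in> S"
  shows "frac R S a s \<oplus>\<^bsub>localization R S\<^esub> frac R S b t = frac R S (t \<otimes> a \<oplus> s \<otimes> b) (s \<otimes> t)"
proof -
  have "congruent2 (frac_rel R S) (frac_rel R S)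
          (\<lambda>p q. case p of (a, s) \<Rightarrow> case q of (b, t) \<Rightarrow> frac R S (t \<otimes> a \<oplus> s \<otimes> b) (s \<otimes> t))"
  proof (rule congruent2_commuteI[OF equiv_frac_rel], goal_cases)
    case (1 y z)
    then show ?case by (auto simp: m_comm a_comm submonoid_carrier)
  next
    case (2 y z w)
    then obtain a s b t c r u where *: "y = (a, s)" "z = (b, t)" "w = (c, r)"
      and c: "a \<in> carrier R" "b \<in> carrier R" "c \<in> carrier R"
      and S: "s \<in> S" "t \<in> S" "r \<in> S" "u \<in> S"
      and e: "u \<otimes> (t \<otimes> a) = u \<otimes> (s \<otimes> b)"
      by (auto simp: frac_rel_def)
    have S': "s \<in> carrier R" "t \<in> carrier R" "r \<in> carrier R" "u \<in> carrier R"
      using S submonoid_carrier by auto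
    have "u \<otimes> ((r \<otimes> t) \<otimes> (s \<otimes> c \<oplus> r \<otimes> a))
        = u \<otimes> r \<otimes> t \<otimes> s \<otimes> c \<oplus> r \<otimes> r \<otimes> (u \<otimes> (t \<otimes> a))"
      using c S' by (simp add: m_ac r_distr)
    also have "\<dots> = u \<otimes> ((r \<otimes> s) \<otimes> (t \<otimes> c \<oplus> r \<otimes> b))"
      unfolding e using c S' by (simp add: m_ac r_distr)
    finally have "frac R S (s \<otimes> c \<oplus> r \<otimes> a) (r \<otimes> s) = frac R S (t \<otimes> c \<oplus> r \<otimes> b) (r \<otimes> t)"
      using c S S' by (intro frac_congI[of _ _ _ _ u]) auto
    then show ?case by (simp add: *)
  qed
  from UN_equiv_class2[OF equiv_frac_rel equiv_frac_rel this, of "(a, s)" "(b, t)"] ab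
  show ?thesis by (simp add: localization_def frac_def case_prod_unfold)
qed

lemma localization_zero: "\<zero>\<^bsub>localization R S\<^esub> = frac R S \<zero> \<one>"
  by (simp add: localization_def)

lemma localization_one: "\<one>\<^bsub>localization R S\<^esub> = frac R S \<one> \<one>"
  by (simp add: localization_def)

lemma localization_cring: "cring (localization R S)"
proof -
  note [simp] = submonoid_carrier localization_zero localization_one localization_mult
    localization_add frac_closed
  have cong: "frac R S a s = frac R S b t"
    if "a \<in> carrier R" "s \<in> S" "b \<in> carrier R" "t \<in> S" "t \<otimes> a = s \<otimes> b" for a s b t
    using that by (intro frac_congI[of _ _ _ _ \<one>]) auto
  show ?thesis
  proof (intro cringI abelian_groupI comm_monoidI, goal_cases)
    case (1 x y)
    then obtain a s b t where "a \<in> carrier R" "s \<in> S" "x = frac R S a s" "b \<in> carrier R" "t \<in> S" "y = frac R S b t"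
      by (elim localization_cases)
    then show ?case
      by simp
  next
    case 2
    then show ?case by simp
  next
    case (3 x y z)
    then obtain a s b t c r where "a \<in> carrier R" "s \<in> S" "x = frac R S a s" "b \<in> carrier R" "t \<in> S" "y = frac R S b t" "c \<in> carrier R" "r \<in> S" "z = frac R S c r"
      by (elim localization_cases)
    then show ?case
      by (simp, intro cong) (simp_all add: m_ac a_ac l_distr r_distr)
  next
    case (4 x y)
    then obtain a s b t where "a \<in> carrier R" "s \<in> S" "x = frac R S a s" "b \<in> carrier R" "t \<in> S" "y = frac R S b t"
      by (elim localization_cases)
    then show ?case
      by (simp, intro cong) (simp_all add: m_ac a_ac l_distr r_distr)
  next
    case (5 x)
    then obtain a s where "a \<in> carrier R" "s \<in> S" "x = frac R S a s"
      by (elim localization_cases)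
    then show ?case
      by simp
  next
    case (6 x)
    then obtain a s where as: "a \<in> carrier R" "s \<in> S" "x = frac R S a s"
      by (rule localization_cases)
    then have "frac R S (s \<otimes> \<ominus> a \<oplus> s \<otimes> a) (s \<otimes> s) = frac R S \<zero> \<one>"
      by (intro cong) (auto simp: r_distr[symmetric] l_neg)
    with as have "frac R S (\<ominus> a) s \<oplus>\<^bsub>localization R S\<^esub> x = \<zero>\<^bsub>localization R S\<^esub>"
      by simp
    then show ?case using as frac_closed[of "\<ominus> a" s] by blast
  next
    case (7 x y)
    then obtain a s b t where "a \<in> carrier R" "s \<in> S" "x = frac R S a s" "b \<in> carrier R" "t \<in> S" "y = frac R S b t"
      by (elim localization_cases)
    then show ?case
      by simp
  next
    case 8
    then show ?case by simp
  next
    case (9 x y z)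
    then obtain a s b t c r where "a \<in> carrier R" "s \<in> S" "x = frac R S a s" "b \<in> carrier R" "t \<in> S" "y = frac R S b t" "c \<in> carrier R" "r \<in> S" "z = frac R S c r"
      by (elim localization_cases)
    then show ?case
      by (simp, intro cong) (simp_all add: m_ac a_ac l_distr r_distr)
  next
    case (10 x)
    then obtain a s where "a \<in> carrier R" "s \<in> S" "x = frac R S a s"
      by (elim localization_cases)
    then show ?case
      by simp
  next
    case (11 x y)
    then obtain a s b t where "a \<in> carrier R" "s \<in> S" "x = frac R S a s" "b \<in> carrier R" "t \<in> S" "y = frac R S b t"
      by (elim localization_cases)
    then show ?case
      by (simp, intro cong) (simp_all add: m_ac a_ac l_distr r_distr)
  next
    case (12 x y z)
    then obtain a s b t c r where "a \<in> carrier R" "s \<in> S" "x = frac R S a s" "b \<in> carrier R" "t \<in> S" "y = frac R S b t" "c \<in> carrier R" "r \<in> S" "z = frac R S c r"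
      by (elim localization_cases)
    then show ?case
      by (simp, intro cong) (simp_all add: m_ac a_ac l_distr r_distr)
  qed
qed

end

end

theory Submission
  imports Defs
begin

text \<open>
  Clearing denominators turns \<open>I I\<^sup>-\<^sup>1 = R\<close> into a condition inside \<open>R\<close>: a regular ideal \<open>I\<close> is
  invertible iff \<open>s \<in> I (sR : I)\<close> for some regular \<open>s\<close>.  Let \<open>L = S\<^sup>-\<^sup>1R\<close>.  A finitely generated
  ideal of \<open>L\<close> is the extension of the ideal \<open>I\<close> of \<open>R\<close> generated by the numerators of its
  generators.  Since \<open>S\<close> consists of regular elements, \<open>a/s\<close> is regular in \<open>L\<close> iff \<open>a\<close> is regular
  in \<open>R\<close>.  So \<open>I\<close> is regular if its extension is, and the membership \<open>s \<in> I (sR : I)\<close>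
  provided by the Pruefer property of \<open>R\<close> carries over to \<open>L\<close>.
\<close>

text \<open>This is the colon ideal \<open>(sR : I)\<close>. For regular \<open>s\<close> it
  collects the numerators \<open>b\<close> of the fractions \<open>b/s\<close> that lie in the
  inverse of \<open>I\<close>.\<close>

definition principal_colon :: "('a, 'm) ring_scheme \<Rightarrow> 'a \<Rightarrow> 'a set \<Rightarrow> 'a set" where
  "principal_colon R s I = {b \<in> carrier R. \<forall>a\<in>I. \<exists>c\<in>carrier R. b \<otimes>\<^bsub>R\<^esub> a = s \<otimes>\<^bsub>R\<^esub> c}"

text \<open>Closure under negation comes from absorbing the factor \<open>\<ominus> \<one>\<close>,
  and absorption on the other side from commutativity.\<close>

lemma (in cring) idealI_cring:
  assumes "I \<subseteq> carrier R" "\<zero> \<in> I"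
    and add: "\<And>a b. \<lbrakk>a \<in> I; b \<in> I\<rbrakk> \<Longrightarrow> a \<oplus> b \<in> I"
    and mult: "\<And>a x. \<lbrakk>a \<in> I; x \<in> carrier R\<rbrakk> \<Longrightarrow> x \<otimes> a \<in> I"
  shows "ideal I R"
proof (rule idealI[OF ring_axioms])
  have carr: "a \<in> carrier R" if "a \<in> I" for a using that assms(1) by blast
  show "subgroup I (add_monoid R)"
  proof (rule add.subgroupI)
    show "\<ominus> a \<in> I" if a: "a \<in> I" for a
    proof -
      have "\<ominus> \<one> \<otimes> a = \<ominus> a" using l_minus[OF one_closed carr[OF a]] carr[OF a] by simp
      then show ?thesis using mult[OF a, of "\<ominus> \<one>"] by simp
    qed
    show "I \<subseteq> carrier R" by (rule assms(1))
    show "I \<noteq> {}" using assms(2) by blast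
    show "a \<oplus> b \<in> I" if "a \<in> I" "b \<in> I" for a b using that by (rule add)
  qed
  show "a \<otimes> x \<in> I" if "a \<in> I" "x \<in> carrier R" for a x
    using mult[OF that] m_comm[OF carr[OF that(1)] that(2)] by simp
qed (rule mult)

section \<open>Regular elements and cancellation\<close>

lemma (in cring) regular_elementI:
  assumes "x \<in> carrier R" "\<one> \<noteq> \<zero>"
    and "\<And>y. \<lbrakk>y \<in> carrier R; x \<otimes> y = \<zero>\<rbrakk> \<Longrightarrow> y = \<zero>"
  shows "x \<in> regular_elements R"
  using assms by (auto simp: regular_elements_def zero_divisors_def)

lemma (in cring) regular_elementD:
  "\<lbrakk>x \<in> regular_elements R; y \<in> carrier R; x \<otimes> y = \<zero>\<rbrakk> \<Longrightarrow> y = \<zero>"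
  by (auto simp: regular_elements_def zero_divisors_def)

lemma regular_elements_carrier: "x \<in> regular_elements R \<Longrightarrow> x \<in> carrier R"
  by (simp add: regular_elements_def)

lemma (in cring) regular_cancel:
  assumes "x \<in> regular_elements R" "a \<in> carrier R" "b \<in> carrier R" "x \<otimes> a = x \<otimes> b"
  shows "a = b"
proof -
  have x: "x \<in> carrier R" using assms(1) by (rule regular_elements_carrier)
  have "x \<otimes> (a \<ominus> b) = \<zero>"
    unfolding minus_eq using x assms(2-4) r_neg[of "x \<otimes> b"]
    by (simp only: r_distr r_minus m_closed a_inv_closed)
  then have "a \<ominus> b = \<zero>"
    using assms(2,3) by (simp add: regular_elementD[OF assms(1)])
  then show ?thesis
    using sum_zero_eq_neg[of a "\<ominus> b"] assms(2,3) by (metis a_inv_closed minus_eq minus_minus)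
qed

text \<open>Zero counts as a zero-divisor even in the zero ring, so that ring has no regular
  element.\<close>

lemma (in cring) one_not_zero_if_regular:
  assumes "x \<in> regular_elements R"
  shows "\<one> \<noteq> \<zero>"
proof
  assume "\<one> = \<zero>"
  then have "x = \<zero>" using regular_elements_carrier[OF assms] by (metis l_null l_one)
  then show False using assms by (auto simp: regular_elements_def zero_divisors_def)
qed

section \<open>Localization at a multiplicative set of regular elements\<close>

locale regular_localization = cring R + submonoid S R for R (structure) and S +
  assumes S_regular: "S \<subseteq> regular_elements R"
begin

abbreviation L where "L \<equiv> localization R S"

sublocale L: cring L
  by (rule localization_cring[OF is_cring submonoid_axioms])

lemmas loc_closed [simp] = frac_closed[OF is_cring submonoid_axioms]
lemmas loc_mult [simp] = localization_mult[OF is_cring submonoid_axioms]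
lemmas loc_add [simp] = localization_add[OF is_cring submonoid_axioms]
lemmas loc_one = localization_one[OF is_cring submonoid_axioms]
lemmas loc_zero = localization_zero[OF is_cring submonoid_axioms]
lemmas loc_cases = localization_cases[OF is_cring submonoid_axioms]

text \<open>The factor \<open>u\<close> in \<open>frac_rel\<close> lies in \<open>S\<close>, hence
  is regular and cancels; conversely \<open>u = \<one>\<close> serves.\<close>

lemma frac_eq_iff_cross:
  assumes "a \<in> carrier R" "s \<in> S" "b \<in> carrier R" "t \<in> S"
  shows "frac R S a s = frac R S b t \<longleftrightarrow> t \<otimes> a = s \<otimes> b"
proof -
  have "t \<otimes> a = s \<otimes> b" if "u \<in> S" "u \<otimes> (t \<otimes> a) = u \<otimes> (s \<otimes> b)" for u
    using regular_cancel[of u] that assms S_regular by auto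
  moreover have "\<one> \<otimes> (t \<otimes> a) = \<one> \<otimes> (s \<otimes> b)" if "t \<otimes> a = s \<otimes> b"
    using that by simp
  ultimately show ?thesis
    unfolding frac_eq_iff[OF is_cring submonoid_axioms assms] using one_closed by blast
qed

lemma frac_eq_zero_iff:
  assumes "a \<in> carrier R" "s \<in> S"
  shows "frac R S a s = \<zero>\<^bsub>L\<^esub> \<longleftrightarrow> a = \<zero>"
  using assms by (simp add: loc_zero frac_eq_iff_cross)

lemma frac_add_same:
  assumes "a \<in> carrier R" "b \<in> carrier R" "s \<in> S"
  shows "frac R S a s \<oplus>\<^bsub>L\<^esub> frac R S b s = frac R S (a \<oplus> b) s"
  using assms by (simp add: frac_eq_iff_cross r_distr m_ac)

lemma one_not_zero: "\<one> \<noteq> \<zero>"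
  using one_not_zero_if_regular S_regular one_closed by blast

text \<open>A fraction vanishes exactly when its numerator does. So \<open>y\<close> kills
  \<open>a\<close> only if \<open>y/1\<close> kills \<open>a/s\<close>, and \<open>b/t\<close> kills
  \<open>a/s\<close> only if \<open>b\<close> kills \<open>a\<close>.\<close>

lemma frac_regular_iff:
  assumes "a \<in> carrier R" "s \<in> S"
  shows "frac R S a s \<in> regular_elements L \<longleftrightarrow> a \<in> regular_elements R"
proof
  assume reg: "frac R S a s \<in> regular_elements L"
  show "a \<in> regular_elements R"
  proof (rule regular_elementI[OF assms(1) one_not_zero])
    fix y assume y: "y \<in> carrier R" "a \<otimes> y = \<zero>"
    then have "frac R S a s \<otimes>\<^bsub>L\<^esub> frac R S y \<one> = \<zero>\<^bsub>L\<^esub>"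
      using assms by (simp add: frac_eq_zero_iff)
    then have "frac R S y \<one> = \<zero>\<^bsub>L\<^esub>"
      using L.regular_elementD[OF reg] y(1) by simp
    then show "y = \<zero>" using y by (simp add: frac_eq_zero_iff)
  qed
next
  assume reg: "a \<in> regular_elements R"
  have "\<one>\<^bsub>L\<^esub> \<noteq> \<zero>\<^bsub>L\<^esub>" using one_not_zero by (simp add: loc_one frac_eq_zero_iff)
  then show "frac R S a s \<in> regular_elements L"
  proof (rule L.regular_elementI[rotated])
    fix y assume "y \<in> carrier L" and 0: "frac R S a s \<otimes>\<^bsub>L\<^esub> y = \<zero>\<^bsub>L\<^esub>"
    then obtain b t where b: "b \<in> carrier R" "t \<in> S" "y = frac R S b t"
      by (elim loc_cases)
    with 0 assms have "a \<otimes> b = \<zero>" by (simp add: frac_eq_zero_iff)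
    then have "b = \<zero>" using regular_elementD[OF reg] b(1) by simp
    then show "y = \<zero>\<^bsub>L\<^esub>" using b by (simp add: frac_eq_zero_iff)
  qed (use assms in simp)
qed

section \<open>Extension of ideals to the localization\<close>

definition extension :: "'a set \<Rightarrow> ('a \<times> 'a) set set" where
  "extension I = {frac R S a s | a s. a \<in> I \<and> s \<in> S}"

lemma extensionI: "\<lbrakk>a \<in> I; s \<in> S\<rbrakk> \<Longrightarrow> frac R S a s \<in> extension I"
  by (auto simp: extension_def)

text \<open>The sum of \<open>a/s\<close> and \<open>b/t\<close> has numerator
  \<open>t a + s b\<close>, again in \<open>I\<close>. This is why \<open>extension\<close> can
  consist of single fractions rather than finite sums.\<close>

lemma extension_ideal:
  assumes "ideal I R"
  shows "ideal (extension I) L"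
proof -
  interpret I: ideal I R by fact
  show ?thesis
  proof (rule L.idealI_cring)
    show "extension I \<subseteq> carrier L" by (auto simp: extension_def)
    show "\<zero>\<^bsub>L\<^esub> \<in> extension I"
      by (simp add: loc_zero extensionI)
  next
    fix x y assume "x \<in> extension I" "y \<in> extension I"
    then show "x \<oplus>\<^bsub>L\<^esub> y \<in> extension I"
      by (fastforce simp: extension_def intro: I.I_l_closed I.a_closed)
  next
    fix x y assume "x \<in> extension I" "y \<in> carrier L"
    then show "y \<otimes>\<^bsub>L\<^esub> x \<in> extension I"
      by (elim loc_cases) (fastforce simp: extension_def intro: I.I_l_closed)
  qed
qed

text \<open>Multiplying by elements of \<open>S\<close>, which become units of \<open>L\<close>,
  passes between a generator and its numerator. Hence the numerators of generators of
  \<open>J\<close> generate a suitable \<open>I\<close>.\<close>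

lemma finitely_generated_extension:
  assumes "finitely_generated_ideal J L"
  obtains I where "finitely_generated_ideal I R" "J = extension I"
proof -
  obtain A where A: "A \<subseteq> carrier L" "finite A" and J: "J = Idl\<^bsub>L\<^esub> A"
    using assms by (auto simp: finitely_generated_ideal_def)
  have "\<forall>x\<in>A. \<exists>p. fst p \<in> carrier R \<and> snd p \<in> S \<and> x = frac R S (fst p) (snd p)"
  proof
    fix x assume "x \<in> A"
    then have "x \<in> carrier L" using A(1) by blast
    then obtain a s where "a \<in> carrier R" "s \<in> S" "x = frac R S a s" by (rule loc_cases)
    then show "\<exists>p. fst p \<in> carrier R \<and> snd p \<in> S \<and> x = frac R S (fst p) (snd p)"
      by (intro exI[of _ "(a, s)"]) simp
  qed
  then obtain p where p: "\<And>x. x \<in> A \<Longrightarrow> fst (p x) \<in> carrier R"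
      "\<And>x. x \<in> A \<Longrightarrow> snd (p x) \<in> S" "\<And>x. x \<in> A \<Longrightarrow> x = frac R S (fst (p x)) (snd (p x))"
    by metis
  define B where "B = (\<lambda>x. fst (p x)) ` A"
  have B: "B \<subseteq> carrier R" using p(1) by (auto simp: B_def)
  interpret I: ideal "Idl B" R using B by (rule genideal_ideal)
  interpret J: ideal J L unfolding J using A(1) by (rule L.genideal_ideal)
  have "A \<subseteq> extension (Idl B)"
    using p genideal_self[OF B] by (fastforce simp: extension_def B_def)
  then have 1: "J \<subseteq> extension (Idl B)"
    unfolding J by (intro L.genideal_minimal extension_ideal I.ideal_axioms)
  \<comment> \<open>This is the contraction of \<open>J\<close> to \<open>R\<close>. Once it is
    known to contain the numerators \<open>B\<close>, it contains \<open>Idl B\<close>.\<close>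
  have "ideal {a \<in> carrier R. frac R S a \<one> \<in> J} R"
  proof (rule idealI_cring)
    show "\<zero> \<in> {a \<in> carrier R. frac R S a \<one> \<in> J}"
      using J.zero_closed by (simp add: loc_zero)
  next
    fix a b assume "a \<in> {a \<in> carrier R. frac R S a \<one> \<in> J}" "b \<in> {a \<in> carrier R. frac R S a \<one> \<in> J}"
    then show "a \<oplus> b \<in> {a \<in> carrier R. frac R S a \<one> \<in> J}"
      using J.a_closed[of "frac R S a \<one>" "frac R S b \<one>"] by simp
  next
    fix a x assume "a \<in> {a \<in> carrier R. frac R S a \<one> \<in> J}" "x \<in> carrier R"
    then show "x \<otimes> a \<in> {a \<in> carrier R. frac R S a \<one> \<in> J}"
      using J.I_l_closed[of "frac R S a \<one>" "frac R S x \<one>"] by simp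
  qed auto
  moreover have "B \<subseteq> {a \<in> carrier R. frac R S a \<one> \<in> J}"
  proof -
    have "frac R S (fst (p x)) \<one> \<in> J" if x: "x \<in> A" for x
    proof -
      note px = p[OF x]
      have "x \<in> J" using x L.genideal_self[OF A(1)] by (auto simp: J)
      \<comment> \<open>Multiplying the generator \<open>x\<close> by its own denominator leaves its
        numerator over \<open>\<one>\<close>.\<close>
      then have "frac R S (snd (p x)) \<one> \<otimes>\<^bsub>L\<^esub> x \<in> J"
        using px by (intro J.I_l_closed) auto
      moreover have "frac R S (snd (p x)) \<one> \<otimes>\<^bsub>L\<^esub> frac R S (fst (p x)) (snd (p x)) =
          frac R S (fst (p x)) \<one>"
        using px(1,2) by (simp add: frac_eq_iff_cross)
      ultimately show ?thesis by (simp flip: px(3))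
    qed
    then show ?thesis using p(1) by (auto simp: B_def)
  qed
  ultimately have 2: "Idl B \<subseteq> {a \<in> carrier R. frac R S a \<one> \<in> J}"
    by (rule genideal_minimal)
  have "frac R S a s \<in> J" if "a \<in> Idl B" "s \<in> S" for a s
  proof -
    have "frac R S \<one> s \<otimes>\<^bsub>L\<^esub> frac R S a \<one> \<in> J"
      using that 2 by (intro J.I_l_closed) auto
    then show ?thesis using that by simp
  qed
  then have "J = extension (Idl B)" using 1 by (auto simp: extension_def)
  moreover have "finitely_generated_ideal (Idl B) R"
    unfolding finitely_generated_ideal_def using B A(2) by (auto simp: B_def)
  ultimately show ?thesis using that by blast
qed

text \<open>From \<open>b c = s d\<close> follows \<open>(b/1)(c/t) = (s/1)(d/t)\<close>, so
  \<open>b/1\<close> lies in the colon ideal of the extension. Membership of \<open>n\<close> in the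
  carrier is part of the induction because adding fractions requires it.\<close>

lemma frac_mem_extension_colon:
  assumes "ideal I R" "s \<in> carrier R" "n \<in> ideal_prod R I (principal_colon R s I)"
  shows "n \<in> carrier R \<and>
    frac R S n \<one> \<in> ideal_prod L (extension I) (principal_colon L (frac R S s \<one>) (extension I))"
  using assms(3)
proof induction
  interpret I: ideal I R by fact
  case (prod a b)
  then have ab: "a \<in> carrier R" "b \<in> carrier R" by (auto simp: principal_colon_def)
  have "\<exists>z\<in>carrier L. frac R S b \<one> \<otimes>\<^bsub>L\<^esub> frac R S c t = frac R S s \<one> \<otimes>\<^bsub>L\<^esub> z"
    if c: "c \<in> I" and t: "t \<in> S" for c t
  proof -
    obtain d where "d \<in> carrier R" "b \<otimes> c = s \<otimes> d"
      using prod c by (auto simp: principal_colon_def)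
    then show ?thesis using t c ab assms(2) by (intro bexI[of _ "frac R S d t"]) auto
  qed
  then have "frac R S b \<one> \<in> principal_colon L (frac R S s \<one>) (extension I)"
    using ab by (auto simp: principal_colon_def extension_def)
  moreover have "frac R S a \<one> \<in> extension I"
    using prod by (simp add: extensionI)
  ultimately show ?case using ideal_prod.prod[of "frac R S a \<one>" _ "frac R S b \<one>" _ L] ab by simp
next
  case (sum m n)
  then show ?case
    using ideal_prod.sum[of "frac R S m \<one>" L _ _ "frac R S n \<one>"] by (simp add: frac_add_same)
qed

end

section \<open>Invertibility expressed inside the ring\<close>

lemma (in cring) ideal_prod_colon_scale:
  assumes "I \<subseteq> carrier R" "s \<in> carrier R" "t \<in> carrier R"
    and "n \<in> ideal_prod R I (principal_colon R s I)"
  shows "n \<in> carrier R \<and> t \<otimes> n \<in> ideal_prod R I (principal_colon R (s \<otimes> t) I)"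
  using assms(4)
proof induction
  case (prod a b)
  then have ab: "a \<in> carrier R" "b \<in> carrier R" using assms by (auto simp: principal_colon_def)
  have "\<exists>d\<in>carrier R. t \<otimes> b \<otimes> c = s \<otimes> t \<otimes> d" if c: "c \<in> I" for c
  proof -
    obtain d where d: "d \<in> carrier R" "b \<otimes> c = s \<otimes> d"
      using prod c by (auto simp: principal_colon_def)
    have "t \<otimes> b \<otimes> c = t \<otimes> (b \<otimes> c)" using ab c assms by (auto simp: m_assoc)
    also have "\<dots> = s \<otimes> t \<otimes> d" using d assms by (simp add: m_ac)
    finally show ?thesis using d by blast
  qed
  \<comment> \<open>The factor \<open>t\<close> is absorbed by the colon ideal, while the factor
    \<open>a\<close> from \<open>I\<close> stays unchanged.\<close>
  then have "t \<otimes> b \<in> principal_colon R (s \<otimes> t) I"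
    using ab assms by (auto simp: principal_colon_def)
  then have "a \<otimes> (t \<otimes> b) \<in> ideal_prod R I (principal_colon R (s \<otimes> t) I)"
    using prod by (intro ideal_prod.prod)
  then show ?case using ab assms by (simp add: m_ac)
next
  case (sum m n)
  then show ?case using assms by (auto simp: r_distr intro: ideal_prod.sum)
qed

text \<open>Invertibility writes \<open>1\<close> as a sum of products of elements of
  \<open>I\<close> and of its inverse. Over a common denominator \<open>s\<close> of the latter,
  this says that \<open>s\<close> is a sum of products \<open>a b\<close> with \<open>a\<close> in
  \<open>I\<close> and \<open>b\<close> in \<open>(sR : I)\<close>. Dividing by \<open>s\<close>
  leads back.\<close>

lemma (in cring) invertible_ideal_iff:
  assumes I: "regular_ideal I R"
  shows "invertible_ideal I R \<longleftrightarrow>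
    (\<exists>s\<in>regular_elements R. s \<in> ideal_prod R I (principal_colon R s I))"
proof -
  interpret I: ideal I R using I by (simp add: regular_ideal_def)
  have ne: "\<one> \<noteq> \<zero>" using I one_not_zero_if_regular by (auto simp: regular_ideal_def)
  interpret reg: submonoid "regular_elements R" R
    by (rule submonoid_regular_elements[OF is_cring ne])
  \<comment> \<open>Taking all regular elements as the multiplicative set makes the same calculus of
    fractions available in \<open>Tot R\<close>.\<close>
  interpret T: regular_localization R "regular_elements R" by unfold_locales simp
  have T: "T.L = Tot R" by (simp add: Tot_def)
  let ?q = "frac R (regular_elements R)"
  have q: "to_Tot R a = ?q a \<one>" for a by (simp add: to_Tot_def)
  \<comment> \<open>By cross-multiplication, \<open>(b/s)(a/1) = c/1\<close> means
    \<open>b a = s c\<close>.\<close>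
  have frac_inverse: "?q b s \<in> ideal_inverse R I \<longleftrightarrow> b \<in> principal_colon R s I"
    if "b \<in> carrier R" "s \<in> regular_elements R" for b s
  proof -
    have "?q b s \<otimes>\<^bsub>T.L\<^esub> to_Tot R a \<in> to_Tot R ` carrier R \<longleftrightarrow> (\<exists>c\<in>carrier R. b \<otimes> a = s \<otimes> c)"
      if "a \<in> I" for a
      using that \<open>b \<in> carrier R\<close> \<open>s \<in> regular_elements R\<close>
      by (auto simp: q image_iff T.frac_eq_iff_cross)
    then show ?thesis using that by (simp add: ideal_inverse_def principal_colon_def flip: T)
  qed
  show ?thesis
  proof
    assume "invertible_ideal I R"
    then have "\<one>\<^bsub>T.L\<^esub> \<in> ideal_prod T.L (to_Tot R ` I) (ideal_inverse R I)"
      by (simp add: invertible_ideal_def T.loc_one flip: q T)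
    \<comment> \<open>The denominator \<open>s\<close> depends on \<open>z\<close>, and the same
      \<open>s\<close> must appear in the colon ideal. Only \<open>z = 1\<close> is used afterwards,
      where it forces \<open>n = s\<close>.\<close>
    moreover have "\<exists>n s. s \<in> regular_elements R \<and> n \<in> ideal_prod R I (principal_colon R s I) \<and>
        n \<in> carrier R \<and> z = ?q n s"
      if "z \<in> ideal_prod T.L (to_Tot R ` I) (ideal_inverse R I)" for z
      using that
    proof induction
      case (prod x y)
      then obtain a where a: "a \<in> I" "x = ?q a \<one>" by (auto simp: q)
      have "y \<in> carrier T.L" using prod by (simp add: ideal_inverse_def T)
      then obtain b s where b: "b \<in> carrier R" "s \<in> regular_elements R" "y = ?q b s"
        by (elim T.loc_cases)
      then have "b \<in> principal_colon R s I" using prod frac_inverse by simp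
      then show ?case using a b
        by (intro exI[of _ "a \<otimes> b"] exI[of _ s]) (auto intro: ideal_prod.prod)
    next
      case (sum x y)
      then obtain m s n t where
        m: "s \<in> regular_elements R" "m \<in> ideal_prod R I (principal_colon R s I)"
           "m \<in> carrier R" "x = ?q m s" and
        n: "t \<in> regular_elements R" "n \<in> ideal_prod R I (principal_colon R t I)"
           "n \<in> carrier R" "y = ?q n t"
        by auto
      \<comment> \<open>Both numerators are rescaled to the common denominator \<open>s t\<close>,
        and their colon ideals change accordingly.\<close>
      have "t \<otimes> m \<in> ideal_prod R I (principal_colon R (s \<otimes> t) I)"
        using ideal_prod_colon_scale[of I s t m] m n I.a_subset by simp
      moreover have "s \<otimes> n \<in> ideal_prod R I (principal_colon R (s \<otimes> t) I)"
        using ideal_prod_colon_scale[of I t s n] m n I.a_subset by (simp add: m_comm)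
      ultimately show ?case using m n
        by (intro exI[of _ "t \<otimes> m \<oplus> s \<otimes> n"] exI[of _ "s \<otimes> t"]) (auto intro: ideal_prod.sum)
    qed
    ultimately obtain n s where s: "s \<in> regular_elements R"
        "n \<in> ideal_prod R I (principal_colon R s I)" "n \<in> carrier R" "\<one>\<^bsub>T.L\<^esub> = ?q n s"
      by blast
    then have "n = s" by (simp add: T.loc_one T.frac_eq_iff_cross)
    then show "\<exists>s\<in>regular_elements R. s \<in> ideal_prod R I (principal_colon R s I)"
      using s by blast
  next
    assume "\<exists>s\<in>regular_elements R. s \<in> ideal_prod R I (principal_colon R s I)"
    then obtain s where s: "s \<in> regular_elements R" "s \<in> ideal_prod R I (principal_colon R s I)"
      by blast
    have "z \<in> to_Tot R ` carrier R"
      if "z \<in> ideal_prod T.L (to_Tot R ` I) (ideal_inverse R I)" for z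
      using that
    proof induction
      case (prod x y)
      then have "x \<in> carrier T.L" "y \<in> carrier T.L" "y \<otimes>\<^bsub>T.L\<^esub> x \<in> to_Tot R ` carrier R"
        by (auto simp: q ideal_inverse_def T[symmetric])
      then show ?case by (simp add: T.L.m_comm)
    next
      case (sum x y)
      then show ?case by (auto simp: q)
    qed
    moreover have "to_Tot R r \<in> ideal_prod T.L (to_Tot R ` I) (ideal_inverse R I)"
      if r: "r \<in> carrier R" for r
    proof -
      \<comment> \<open>The factor \<open>r\<close> goes into \<open>I\<close> and the denominator
        \<open>s\<close> stays fixed throughout the induction. The instance \<open>n = s\<close>
        then gives \<open>(r s)/s = r/1\<close>.\<close>
      have "n \<in> carrier R \<and>
          ?q (r \<otimes> n) s \<in> ideal_prod T.L (to_Tot R ` I) (ideal_inverse R I)"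
        if "n \<in> ideal_prod R I (principal_colon R s I)" for n
        using that
      proof induction
        case (prod a b)
        then have ab: "a \<in> carrier R" "b \<in> carrier R" by (auto simp: principal_colon_def)
        then have "to_Tot R (r \<otimes> a) \<otimes>\<^bsub>T.L\<^esub> ?q b s \<in>
            ideal_prod T.L (to_Tot R ` I) (ideal_inverse R I)"
          using prod r s(1) by (intro ideal_prod.prod) (auto simp: frac_inverse I.I_l_closed)
        then show ?case using ab r s(1) by (simp add: q m_ac)
      next
        case (sum m n)
        then have "?q (r \<otimes> m) s \<oplus>\<^bsub>T.L\<^esub> ?q (r \<otimes> n) s \<in>
            ideal_prod T.L (to_Tot R ` I) (ideal_inverse R I)"
          by (intro ideal_prod.sum) simp_all
        moreover have "?q (r \<otimes> m) s \<oplus>\<^bsub>T.L\<^esub> ?q (r \<otimes> n) s = ?q (r \<otimes> (m \<oplus> n)) s"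
          using sum r s(1) by (subst T.frac_add_same) (simp_all add: r_distr)
        ultimately show ?case using sum by simp
      qed
      from this[OF s(2)] have "?q (r \<otimes> s) s \<in> ideal_prod T.L (to_Tot R ` I) (ideal_inverse R I)"
        by simp
      moreover have "?q (r \<otimes> s) s = to_Tot R r"
        using r s(1) by (simp add: q T.frac_eq_iff_cross m_comm)
      ultimately show ?thesis by simp
    qed
    ultimately show "invertible_ideal I R"
      using I by (auto simp: invertible_ideal_def T[symmetric])
  qed
qed

section \<open>Transfer of the Pruefer property to the localization\<close>

theorem theorem2p1:
  fixes R :: "('a, 'm) ring_scheme" and S :: "'a set"
  assumes "pruefer_ring R"
    and "submonoid S R"
    and "S \<subseteq> carrier R - zero_divisors R"
  shows "pruefer_ring (localization R S)"
proof -
  interpret pruefer_ring R by fact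
  interpret submonoid S R by fact
  interpret regular_localization R S
    using assms(3) by unfold_locales (simp add: regular_elements_def)
  show ?thesis
  proof
    fix J assume fg: "finitely_generated_ideal J L" and J: "regular_ideal J L"
    obtain I where I: "finitely_generated_ideal I R" and JI: "J = extension I"
      using fg by (rule finitely_generated_extension)
    have id: "ideal I R" using I genideal_ideal by (auto simp: finitely_generated_ideal_def)
    then interpret I: ideal I R .
    obtain a s where "a \<in> I" "s \<in> S" "frac R S a s \<in> regular_elements L"
      using J by (auto simp: regular_ideal_def JI extension_def)
    then have reg: "regular_ideal I R"
      using id by (auto simp: regular_ideal_def frac_regular_iff)
    with I have "invertible_ideal I R" by (rule fin_gen_regular_invertible)
    then obtain s where s: "s \<in> regular_elements R" "s \<in> ideal_prod R I (principal_colon R s I)"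
      using reg by (auto simp: invertible_ideal_iff)
    then have sc: "s \<in> carrier R" by (simp add: regular_elements_carrier)
    \<comment> \<open>The witness for \<open>J\<close> is \<open>s/1\<close>, the image of the
      witness for \<open>I\<close>.\<close>
    have "frac R S s \<one>\<^bsub>R\<^esub> \<in> regular_elements L" using s sc by (simp add: frac_regular_iff)
    then show "invertible_ideal J L"
      using frac_mem_extension_colon[OF id sc s(2)] J by (auto simp: L.invertible_ideal_iff JI)
  qed
qed

end
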